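(* Let $S$ and $T$ be quandles and let $K$ be the set of identities satisfied by $T$. Then $\mathrm{Hom}(S,T)\cong\mathrm{Hom}(S/\mathrm{Cg}(K),T)$ as sets (i.e. there is a bijection between these two sets).
   Context: A quandle is a set $Q$ with a binary operation $\triangleright$ such that $x\triangleright x=x$; for all $y,z$ there is a unique $x$ with $y\triangleright x=z$ (left divisibility); and $x\triangleright(y\triangleright z)=(x\triangleright y)\triangleright(x\triangleright z)$. $\mathrm{Hom}(S,T)$ is the set of quandle homomorphisms from $S$ to $T$. An identity is an equation $p(x_1,\dots,x_n)=q(x_1,\dots,x_n)$ between quandle terms; $T$ satisfies it if it holds for all values of the variables in $T$. A congruence on $S$ is an equivalence relation compatible with $\triangleright$ and with left division, so that the quotient is again a quandle. For a collection $K$ of identities, $\mathrm{Cg}(K)$ is the congruence on $S$ generated by $K$: the minimal congruence $\sim$ on $S$ such that $a\sim b$ whenever there exist $x_1,\dots,x_n\in S$ and an identity $p=q$ in $K$ with $a=p(x_1,\dots,x_n)$ and $b=q(x_1,\dots,x_n)$. *)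

theory Defs
  imports "HOL-Algebra.Congruence" "HOL-Library.FuncSet"
begin

record 'a quandle_struct = "'a partial_object" +
  qop :: "'a \<Rightarrow> 'a \<Rightarrow> 'a" (infixl \<open>\<rhd>\<index>\<close> 70)

locale quandle =
  fixes Q (structure)
  assumes qop_closed: "\<lbrakk>x \<in> carrier Q; y \<in> carrier Q\<rbrakk> \<Longrightarrow> x \<rhd> y \<in> carrier Q"
    and qop_idem: "x \<in> carrier Q \<Longrightarrow> x \<rhd> x = x"
    and left_divisible: "\<lbrakk>y \<in> carrier Q; z \<in> carrier Q\<rbrakk> \<Longrightarrow> \<exists>!x. x \<in> carrier Q \<and> y \<rhd> x = z"
    and left_distrib: "\<lbrakk>x \<in> carrier Q; y \<in> carrier Q; z \<in> carrier Q\<rbrakk>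
      \<Longrightarrow> x \<rhd> (y \<rhd> z) = (x \<rhd> y) \<rhd> (x \<rhd> z)"

text \<open>Left division: \<open>left_div Q y z\<close> is the unique \<open>x\<close> with \<open>y \<rhd> x = z\<close>.\<close>

definition left_div :: "('a, 'm) quandle_struct_scheme \<Rightarrow> 'a \<Rightarrow> 'a \<Rightarrow> 'a" where
  "left_div Q y z = (THE x. x \<in> carrier Q \<and> y \<rhd>\<^bsub>Q\<^esub> x = z)"

text \<open>Homomorphisms are taken to be extensional, so that two of them are equal
  iff they agree on the carrier of the source.\<close>

definition quandle_hom ::
    "('a, 'm) quandle_struct_scheme \<Rightarrow> ('b, 'n) quandle_struct_scheme \<Rightarrow> ('a \<Rightarrow> 'b) set" where
  "quandle_hom S T = {f \<in> carrier S \<rightarrow>\<^sub>E carrier T.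
     \<forall>x\<in>carrier S. \<forall>y\<in>carrier S. f (x \<rhd>\<^bsub>S\<^esub> y) = f x \<rhd>\<^bsub>T\<^esub> f y}"

text \<open>Terms in the signature of quandles, i.e. built from the operation and left division.
  A term contains finitely many variables and at least one, so an identity in
  \<open>n\<close> variables may be evaluated at a sequence of elements of the carrier.\<close>

datatype qterm = Var nat | Op qterm qterm | LDiv qterm qterm

type_synonym identity = "qterm \<times> qterm"

primrec qeval :: "('a, 'm) quandle_struct_scheme \<Rightarrow> (nat \<Rightarrow> 'a) \<Rightarrow> qterm \<Rightarrow> 'a" where
  "qeval Q v (Var i) = v i"
| "qeval Q v (Op s t) = qeval Q v s \<rhd>\<^bsub>Q\<^esub> qeval Q v t"
| "qeval Q v (LDiv s t) = left_div Q (qeval Q v s) (qeval Q v t)"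

definition satisfies :: "('a, 'm) quandle_struct_scheme \<Rightarrow> identity \<Rightarrow> bool" where
  "satisfies Q e \<longleftrightarrow>
     (\<forall>v. range v \<subseteq> carrier Q \<longrightarrow> qeval Q v (fst e) = qeval Q v (snd e))"

definition identities_of :: "('a, 'm) quandle_struct_scheme \<Rightarrow> identity set" where
  "identities_of Q = {e. satisfies Q e}"

definition quandle_congruence :: "('a, 'm) quandle_struct_scheme \<Rightarrow> 'a rel \<Rightarrow> bool" where
  "quandle_congruence S r \<longleftrightarrow> equiv (carrier S) r \<and>
     (\<forall>(a, a') \<in> r. \<forall>(b, b') \<in> r.
        (a \<rhd>\<^bsub>S\<^esub> b, a' \<rhd>\<^bsub>S\<^esub> b') \<in> r \<and> (left_div S a b, left_div S a' b') \<in> r)"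

definition identity_pairs :: "('a, 'm) quandle_struct_scheme \<Rightarrow> identity set \<Rightarrow> 'a rel" where
  "identity_pairs S K =
     {(qeval S v p, qeval S v q) | v p q. range v \<subseteq> carrier S \<and> (p, q) \<in> K}"

definition Cg :: "('a, 'm) quandle_struct_scheme \<Rightarrow> identity set \<Rightarrow> 'a rel" where
  "Cg S K = \<Inter> {r. quandle_congruence S r \<and> identity_pairs S K \<subseteq> r}"

definition quandle_quot :: "('a, 'm) quandle_struct_scheme \<Rightarrow> 'a rel \<Rightarrow> 'a set quandle_struct" where
  "quandle_quot S r = \<lparr>carrier = carrier S // r,
     qop = (\<lambda>A B. \<Union>a\<in>A. \<Union>b\<in>B. r `` {a \<rhd>\<^bsub>S\<^esub> b})\<rparr>"


text \<open>The definitions above make sense: \<open>Cg S K\<close> is the least congruence containing the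
  instances of \<open>K\<close>, and the quotient by a congruence is a quandle.\<close>

lemma left_div_props:
  assumes "quandle Q" "y \<in> carrier Q" "z \<in> carrier Q"
  shows left_div_closed: "left_div Q y z \<in> carrier Q"
    and qop_left_div: "y \<rhd>\<^bsub>Q\<^esub> left_div Q y z = z"
  using theI'[OF quandle.left_divisible[OF assms]] by (simp_all add: left_div_def)

lemma left_div_qop:
  assumes "quandle Q" "y \<in> carrier Q" "x \<in> carrier Q"
  shows "left_div Q y (y \<rhd>\<^bsub>Q\<^esub> x) = x"
proof -
  have "y \<rhd>\<^bsub>Q\<^esub> x \<in> carrier Q"
    using assms by (simp add: quandle.qop_closed)
  from quandle.left_divisible[OF assms(1,2) this] show ?thesis
    unfolding left_div_def using assms(3) by (auto intro!: the1_equality)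
qed

lemma qeval_closed:
  assumes "quandle Q" "range v \<subseteq> carrier Q"
  shows "qeval Q v t \<in> carrier Q"
  using assms by (induction t) (auto simp: left_div_closed quandle.qop_closed)

lemma quandle_congruenceD:
  assumes "quandle_congruence S r" "(a, a') \<in> r" "(b, b') \<in> r"
  shows "(a \<rhd>\<^bsub>S\<^esub> b, a' \<rhd>\<^bsub>S\<^esub> b') \<in> r" "(left_div S a b, left_div S a' b') \<in> r"
  using assms unfolding quandle_congruence_def by auto

lemma quandle_congruence_full:
  assumes "quandle S"
  shows "quandle_congruence S (carrier S \<times> carrier S)"
proof -
  have "equiv (carrier S) (carrier S \<times> carrier S)"
    by (intro equivI refl_onI symI transI) auto
  then show ?thesis
    using left_div_closed[OF assms] quandle.qop_closed[OF assms]
    by (simp add: quandle_congruence_def)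
qed

lemma quandle_congruence_Inter:
  assumes "R \<noteq> {}" "\<And>r. r \<in> R \<Longrightarrow> quandle_congruence S r"
  shows "quandle_congruence S (\<Inter>R)"
proof -
  have eq: "equiv (carrier S) r" if "r \<in> R" for r
    using assms(2)[OF that] by (simp add: quandle_congruence_def)
  have "equiv (carrier S) (\<Inter>R)"
  proof (rule equivI)
    show "\<Inter>R \<subseteq> carrier S \<times> carrier S"
      using assms(1) eq by (fastforce dest: equiv_type)
    show "refl_on (carrier S) (\<Inter>R)"
      using eq by (auto simp: equiv_def refl_on_def)
    show "sym (\<Inter>R)"
      using eq by (meson InterE InterI equivE symD symI)
    show "trans (\<Inter>R)"
      using eq by (meson InterE InterI equivE transD transI)
  qed
  moreover have "(a \<rhd>\<^bsub>S\<^esub> b, a' \<rhd>\<^bsub>S\<^esub> b') \<in> \<Inter>R \<and> (left_div S a b, left_div S a' b') \<in> \<Inter>R"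
    if "(a, a') \<in> \<Inter>R" "(b, b') \<in> \<Inter>R" for a a' b b'
    using that by (auto dest: quandle_congruenceD[OF assms(2)])
  ultimately show ?thesis
    unfolding quandle_congruence_def by auto
qed

lemma quandle_congruence_Cg:
  assumes "quandle S"
  shows "quandle_congruence S (Cg S K)"
  unfolding Cg_def
proof (rule quandle_congruence_Inter)
  have "identity_pairs S K \<subseteq> carrier S \<times> carrier S"
    using assms by (auto simp: identity_pairs_def qeval_closed)
  then show "{r. quandle_congruence S r \<and> identity_pairs S K \<subseteq> r} \<noteq> {}"
    using quandle_congruence_full[OF assms] by blast
qed simp

lemma identity_pairs_subset_Cg: "identity_pairs S K \<subseteq> Cg S K"
  by (auto simp: Cg_def)

lemma Cg_least:
  "\<lbrakk>quandle_congruence S r; identity_pairs S K \<subseteq> r\<rbrakk> \<Longrightarrow> Cg S K \<subseteq> r"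
  by (auto simp: Cg_def)

lemma qop_quandle_quot:
  assumes "quandle_congruence S r" "a \<in> carrier S" "b \<in> carrier S"
  shows "r `` {a} \<rhd>\<^bsub>quandle_quot S r\<^esub> r `` {b} = r `` {a \<rhd>\<^bsub>S\<^esub> b}"
proof -
  have eq: "equiv (carrier S) r"
    using assms(1) by (simp add: quandle_congruence_def)
  have "congruent2 r r (\<lambda>a b. r `` {a \<rhd>\<^bsub>S\<^esub> b})"
    unfolding congruent2_def
    by (intro ballI) (auto intro!: equiv_class_eq[OF eq] quandle_congruenceD(1)[OF assms(1)])
  from UN_equiv_class2[OF eq eq this assms(2,3)] show ?thesis
    by (simp add: quandle_quot_def)
qed

lemma quandle_quandle_quot:
  assumes S: "quandle S" and r: "quandle_congruence S r"
  shows "quandle (quandle_quot S r)"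
proof -
  let ?Q = "quandle_quot S r"
  have eq: "equiv (carrier S) r"
    using r by (simp add: quandle_congruence_def)
  note op = qop_quandle_quot[OF r]
  have cls: "r `` {a} \<in> carrier ?Q" if "a \<in> carrier S" for a
    using that by (simp add: quandle_quot_def quotientI)
  have rep: "\<exists>a\<in>carrier S. A = r `` {a}" if "A \<in> carrier ?Q" for A
    using that by (auto simp: quandle_quot_def elim: quotientE)
  show ?thesis
  proof
    fix A B assume "A \<in> carrier ?Q" "B \<in> carrier ?Q"
    then obtain a b where ab: "a \<in> carrier S" "b \<in> carrier S" "A = r `` {a}" "B = r `` {b}"
      using rep by metis
    then show "A \<rhd>\<^bsub>?Q\<^esub> B \<in> carrier ?Q"
      using S by (simp add: op cls quandle.qop_closed)
    show "\<exists>!X. X \<in> carrier ?Q \<and> A \<rhd>\<^bsub>?Q\<^esub> X = B"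
    proof (rule ex1I)
      show "r `` {left_div S a b} \<in> carrier ?Q \<and> A \<rhd>\<^bsub>?Q\<^esub> r `` {left_div S a b} = B"
        using S ab by (simp add: op cls left_div_closed qop_left_div)
      fix X assume X: "X \<in> carrier ?Q \<and> A \<rhd>\<^bsub>?Q\<^esub> X = B"
      then obtain x where x: "x \<in> carrier S" "X = r `` {x}" using rep by blast
      have "r `` {a \<rhd>\<^bsub>S\<^esub> x} = r `` {b}" using X x ab by (simp add: op)
      then have "(a \<rhd>\<^bsub>S\<^esub> x, b) \<in> r"
        using eq_equiv_class[OF _ eq] ab by blast
      moreover have "(a, a) \<in> r" using eq ab by (auto simp: equiv_def refl_on_def)
      ultimately have "(left_div S a (a \<rhd>\<^bsub>S\<^esub> x), left_div S a b) \<in> r"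
        using x ab by (intro quandle_congruenceD(2)[OF r])
      then show "X = r `` {left_div S a b}"
        using S ab x by (simp add: left_div_qop equiv_class_eq[OF eq])
    qed
  next
    fix A assume "A \<in> carrier ?Q"
    then show "A \<rhd>\<^bsub>?Q\<^esub> A = A"
      using rep[of A] S by (auto simp: op quandle.qop_idem)
  next
    fix A B C assume "A \<in> carrier ?Q" "B \<in> carrier ?Q" "C \<in> carrier ?Q"
    then obtain a b c where "a \<in> carrier S" "b \<in> carrier S" "c \<in> carrier S"
        "A = r `` {a}" "B = r `` {b}" "C = r `` {c}"
      using rep by metis
    then show "A \<rhd>\<^bsub>?Q\<^esub> (B \<rhd>\<^bsub>?Q\<^esub> C) = (A \<rhd>\<^bsub>?Q\<^esub> B) \<rhd>\<^bsub>?Q\<^esub> (A \<rhd>\<^bsub>?Q\<^esub> C)"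
      using S by (simp add: op quandle.qop_closed flip: quandle.left_distrib)
  qed
qed

end

(* The kernel of a homomorphism f from S to T is a congruence. Since f commutes with the evaluation
   of terms, the two sides of an identity of T have the same image under f, so the kernel contains
   Cg(K). Hence every f factors uniquely through S/Cg(K). *)
theory Submission
  imports Defs
begin

lemma quandle_homI:
  assumes "f \<in> carrier S \<rightarrow>\<^sub>E carrier T"
    and "\<And>x y. \<lbrakk>x \<in> carrier S; y \<in> carrier S\<rbrakk> \<Longrightarrow> f (x \<rhd>\<^bsub>S\<^esub> y) = f x \<rhd>\<^bsub>T\<^esub> f y"
  shows "f \<in> quandle_hom S T"
  using assms by (simp add: quandle_hom_def)

lemma quandle_hom_funcset: "f \<in> quandle_hom S T \<Longrightarrow> f \<in> carrier S \<rightarrow>\<^sub>E carrier T"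
  by (simp add: quandle_hom_def)

lemma quandle_hom_closed: "\<lbrakk>f \<in> quandle_hom S T; x \<in> carrier S\<rbrakk> \<Longrightarrow> f x \<in> carrier T"
  by (auto simp: quandle_hom_def)

lemma quandle_hom_qop:
  "\<lbrakk>f \<in> quandle_hom S T; x \<in> carrier S; y \<in> carrier S\<rbrakk> \<Longrightarrow> f (x \<rhd>\<^bsub>S\<^esub> y) = f x \<rhd>\<^bsub>T\<^esub> f y"
  by (simp add: quandle_hom_def)

text \<open>Homomorphisms are only required to respect \<open>qop\<close>. Left division follows by
  uniqueness of quotients in \<open>T\<close>: the image of \<open>left_div S x y\<close> solves the
  division problem for \<open>f x\<close> and \<open>f y\<close>.\<close>

lemma quandle_hom_left_div:
  assumes S: "quandle S" and T: "quandle T" and f: "f \<in> quandle_hom S T"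
    and x: "x \<in> carrier S" and y: "y \<in> carrier S"
  shows "f (left_div S x y) = left_div T (f x) (f y)"
proof -
  have d: "left_div S x y \<in> carrier S"
    using S x y by (rule left_div_closed)
  \<comment> \<open>Dividing the product by \<open>f x\<close> in \<open>T\<close> recovers the
    second factor; the next step identifies that product with \<open>f y\<close>.\<close>
  have "left_div T (f x) (f x \<rhd>\<^bsub>T\<^esub> f (left_div S x y)) = f (left_div S x y)"
    using T f x d by (simp add: left_div_qop quandle_hom_closed)
  moreover have "f x \<rhd>\<^bsub>T\<^esub> f (left_div S x y) = f y"
    using quandle_hom_qop[OF f x d] S x y by (simp add: qop_left_div)
  ultimately show ?thesis by simp
qed

text \<open>Induction on the term; the \<open>LDiv\<close> case rests on the preservation of left
  division.\<close>

lemma quandle_hom_qeval: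
  assumes "quandle S" "quandle T" "f \<in> quandle_hom S T" "range v \<subseteq> carrier S"
  shows "f (qeval S v t) = qeval T (f \<circ> v) t"
  using assms
  by (induction t) (simp_all add: quandle_hom_qop quandle_hom_left_div qeval_closed)

text \<open>Restricted to the carrier, so that it is an equivalence on \<open>carrier S\<close> and
  not on the whole type.\<close>

definition quandle_kernel ::
    "('a, 'm) quandle_struct_scheme \<Rightarrow> ('a \<Rightarrow> 'b) \<Rightarrow> 'a rel" where
  "quandle_kernel S f = {(a, b). a \<in> carrier S \<and> b \<in> carrier S \<and> f a = f b}"

lemma quandle_congruence_kernel:
  assumes S: "quandle S" and T: "quandle T" and f: "f \<in> quandle_hom S T"
  shows "quandle_congruence S (quandle_kernel S f)"
proof -
  have "equiv (carrier S) (quandle_kernel S f)"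
    by (intro equivI refl_onI symI transI) (auto simp: quandle_kernel_def)
  then show ?thesis
    using quandle.qop_closed[OF S] left_div_closed[OF S] quandle_hom_qop[OF f]
      quandle_hom_left_div[OF S T f]
    by (auto simp: quandle_congruence_def quandle_kernel_def)
qed

text \<open>A valuation \<open>v\<close> in \<open>S\<close> becomes the valuation
  \<open>f \<circ> v\<close> in \<open>T\<close>, where the identity holds; this makes the values of
  both sides in \<open>S\<close> have equal images.\<close>

lemma identity_pairs_subset_kernel:
  assumes S: "quandle S" and T: "quandle T" and f: "f \<in> quandle_hom S T"
  shows "identity_pairs S (identities_of T) \<subseteq> quandle_kernel S f"
proof
  fix z assume "z \<in> identity_pairs S (identities_of T)"
  then obtain v p q where z: "z = (qeval S v p, qeval S v q)" and v: "range v \<subseteq> carrier S"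
      and pq: "satisfies T (p, q)"
    by (auto simp: identity_pairs_def identities_of_def)
  have "range (f \<circ> v) \<subseteq> carrier T"
    using v quandle_hom_closed[OF f] by auto
  then have "qeval T (f \<circ> v) p = qeval T (f \<circ> v) q"
    using pq by (simp add: satisfies_def)
  then show "z \<in> quandle_kernel S f"
    using z quandle_hom_qeval[OF S T f v] qeval_closed[OF S v] by (simp add: quandle_kernel_def)
qed

lemma Cg_identities_subset_kernel:
  assumes "quandle S" "quandle T" "f \<in> quandle_hom S T"
  shows "Cg S (identities_of T) \<subseteq> quandle_kernel S f"
  by (rule Cg_least[OF quandle_congruence_kernel[OF assms] identity_pairs_subset_kernel[OF assms]])

text \<open>Universal property of the quotient, for any congruence that every homomorphism to
  \<open>T\<close> collapses. The map is composition with the projection; \<open>ker\<close> gives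
  its surjectivity.\<close>

lemma bij_betw_quandle_hom_quot:
  assumes S: "quandle S" and r: "quandle_congruence S r"
    and ker: "\<And>f. f \<in> quandle_hom S T \<Longrightarrow> r \<subseteq> quandle_kernel S f"
  shows "bij_betw (\<lambda>g. \<lambda>a\<in>carrier S. g (r `` {a}))
    (quandle_hom (quandle_quot S r) T) (quandle_hom S T)"
    (is "bij_betw ?pull (quandle_hom ?Q T) _")
proof -
  have eq: "equiv (carrier S) r"
    using r by (simp add: quandle_congruence_def)
  note op = qop_quandle_quot[OF r]
  have cls: "r `` {a} \<in> carrier ?Q" if "a \<in> carrier S" for a
    using that by (simp add: quandle_quot_def quotientI)
  have rep: "\<exists>a\<in>carrier S. A = r `` {a}" if "A \<in> carrier ?Q" for A
    using that by (auto simp: quandle_quot_def elim: quotientE)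
  have pull: "?pull g \<in> quandle_hom S T" if g: "g \<in> quandle_hom ?Q T" for g
  proof (rule quandle_homI)
    show "?pull g \<in> carrier S \<rightarrow>\<^sub>E carrier T"
      using g by (auto intro: quandle_hom_closed cls)
    fix x y assume "x \<in> carrier S" "y \<in> carrier S"
    then show "?pull g (x \<rhd>\<^bsub>S\<^esub> y) = ?pull g x \<rhd>\<^bsub>T\<^esub> ?pull g y"
      using quandle_hom_qop[OF g cls cls, of x y] by (simp add: op quandle.qop_closed[OF S])
  qed
  show ?thesis
  proof (rule bij_betw_imageI)
    \<comment> \<open>The projection is onto, so values on classes of elements determine
      \<open>g\<close>.\<close>
    show "inj_on ?pull (quandle_hom ?Q T)"
    proof (rule inj_onI)
      fix g g' assume g: "g \<in> quandle_hom ?Q T" and g': "g' \<in> quandle_hom ?Q T"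
        and pull_eq: "?pull g = ?pull g'"
      show "g = g'"
        using quandle_hom_funcset[OF g] quandle_hom_funcset[OF g']
      proof (rule PiE_ext)
        fix A assume "A \<in> carrier ?Q"
        then obtain a where "a \<in> carrier S" "A = r `` {a}"
          using rep by blast
        then show "g A = g' A"
          using fun_cong[OF pull_eq, of a] by simp
      qed
    qed
    have "f \<in> ?pull ` quandle_hom ?Q T" if f: "f \<in> quandle_hom S T" for f
    proof
      \<comment> \<open>The induced map evaluates \<open>f\<close> at a chosen representative; since
        \<open>r\<close> lies in the kernel of \<open>f\<close>, the choice does not affect the
        value.\<close>
      define g where "g = (\<lambda>A\<in>carrier ?Q. f (SOME a. a \<in> A))"
      have g_cls: "g (r `` {a}) = f a" if a: "a \<in> carrier S" for a
      proof -
        have "(SOME b. b \<in> r `` {a}) \<in> r `` {a}"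
          using equiv_class_self[OF eq a] by (rule someI)
        then have "(a, SOME b. b \<in> r `` {a}) \<in> quandle_kernel S f"
          using ker[OF f] by blast
        then show ?thesis
          using cls[OF a] by (simp add: g_def quandle_kernel_def)
      qed
      show "g \<in> quandle_hom ?Q T"
      proof (rule quandle_homI)
        have "g A \<in> carrier T" if "A \<in> carrier ?Q" for A
          using rep[OF that] g_cls quandle_hom_closed[OF f] by auto
        then show "g \<in> carrier ?Q \<rightarrow>\<^sub>E carrier T"
          by (auto simp: g_def)
        fix A B assume "A \<in> carrier ?Q" "B \<in> carrier ?Q"
        then obtain a b where "a \<in> carrier S" "b \<in> carrier S" "A = r `` {a}" "B = r `` {b}"
          using rep by metis
        then show "g (A \<rhd>\<^bsub>?Q\<^esub> B) = g A \<rhd>\<^bsub>T\<^esub> g B"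
          by (simp add: op g_cls quandle.qop_closed[OF S] quandle_hom_qop[OF f])
      qed
      \<comment> \<open>Off \<open>carrier S\<close> both sides are \<open>undefined\<close>, by
        extensionality.\<close>
      show "f = ?pull g"
        using quandle_hom_funcset[OF f] by (auto simp: g_cls PiE_def extensional_def)
    qed
    then show "?pull ` quandle_hom ?Q T = quandle_hom S T"
      using pull by blast
  qed
qed

theorem theorem3p3:
  fixes S :: "('a, 'm) quandle_struct_scheme" and T :: "('b, 'n) quandle_struct_scheme"
    and K :: "identity set"
  assumes "quandle S" and "quandle T" and "K = identities_of T"
  shows "\<exists>h. bij_betw h (quandle_hom S T) (quandle_hom (quandle_quot S (Cg S K)) T)"
proof (rule exI)
  have "Cg S K \<subseteq> quandle_kernel S f" if "f \<in> quandle_hom S T" for f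
    using Cg_identities_subset_kernel[OF assms(1,2) that] assms(3) by simp
  \<comment> \<open>Composition with the projection runs from the homomorphisms on the quotient to
    those on \<open>S\<close>, so its inverse is the required bijection.\<close>
  from bij_betw_inv_into[OF bij_betw_quandle_hom_quot[OF assms(1)
      quandle_congruence_Cg[OF assms(1)] this]]
  show "bij_betw (inv_into (quandle_hom (quandle_quot S (Cg S K)) T)
        (\<lambda>g. \<lambda>a\<in>carrier S. g (Cg S K `` {a})))
      (quandle_hom S T) (quandle_hom (quandle_quot S (Cg S K)) T)" .
qed

end
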